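(* Let $(\mathbb{Z},b,m)$ be a star with two rays which is transient only at $\infty$ (that is, transient at $\infty$ and not transient at $-\infty$). Then $(\mathbb{Z},b,m)$ does not satisfy the $\ell^2$-Liouville property if and only if $L_c^{(-\infty)}$ is not essentially self-adjoint and at least one of the following holds: (1) $g\in\ell^2(\infty)$. (2) $m(\infty)<\infty$.
   Context: A star with two rays $(\mathbb{Z},b,m)$ consists of the vertex set $\mathbb{Z}$, a symmetric $b\colon\mathbb{Z}\times\mathbb{Z}\to[0,\infty)$ with $b(x,y)>0$ iff $|x-y|=1$, and $m\colon\mathbb{Z}\to(0,\infty)$. All functions are real-valued; $\ell^2(\mathbb{Z},m)$ is the space of $f$ with $\sum_x f^2(x)m(x)<\infty$. The formal Laplacian is $\Delta f(x)=\frac1{m(x)}\sum_y b(x,y)(f(x)-f(y))$. A function $f$ is harmonic if $\Delta f=0$. The $\ell^2$-Liouville property holds if every harmonic function in $\ell^2(\mathbb{Z},m)$ is constant. The graph is transient at $\infty$ if $\sum_{k=0}^\infty\frac1{b(k,k+1)}<\infty$ and transient at $-\infty$ if $\sum_{k=0}^\infty\frac1{b(-k,-k-1)}<\infty$. One writes $g\in\ell^2(\infty)$ (the Green's function is in $\ell^2$ at infinity) if $\sum_{r=0}^\infty\left(\sum_{k=r}^\infty\frac1{b(k,k+1)}\right)^2m(r)<\infty$. One writes $m(\infty)<\infty$ if $\sum_{r=0}^\infty m(r)<\infty$. $L_c^{(-\infty)}$ is the Laplacian of the negative part of the graph, i.e. of the subgraph induced on $\{-1,-2,-3,\ldots\}$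 (with $b$ and $m$ restricted), restricted to the finitely supported functions and viewed as an operator on the corresponding $\ell^2$ space. An operator is essentially self-adjoint if it has a unique self-adjoint extension (equivalently, its closure is self-adjoint). *)

theory Defs
  imports "HOL-Analysis.Infinite_Sum"
begin

section \<open>Weighted square-summable functions\<close>

text \<open>A function on a vertex set \<open>X\<close> is represented by a function on the whole type that
  vanishes outside \<open>X\<close>, so that equality of functions on \<open>X\<close> is equality in HOL.\<close>

definition l2 :: "'a set \<Rightarrow> ('a \<Rightarrow> real) \<Rightarrow> ('a \<Rightarrow> real) set" where
  "l2 X m = {f. (\<forall>x. x \<notin> X \<longrightarrow> f x = 0) \<and> (\<lambda>x. (f x)\<^sup>2 * m x) summable_on X}"

definition l2_inner :: "'a set \<Rightarrow> ('a \<Rightarrow> real) \<Rightarrow> ('a \<Rightarrow> real) \<Rightarrow> ('a \<Rightarrow> real) \<Rightarrow> real" where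
  "l2_inner X m f g = (\<Sum>\<^sub>\<infinity>x\<in>X. f x * g x * m x)"

definition l2_norm :: "'a set \<Rightarrow> ('a \<Rightarrow> real) \<Rightarrow> ('a \<Rightarrow> real) \<Rightarrow> real" where
  "l2_norm X m f = sqrt (l2_inner X m f f)"


section \<open>Unbounded operators\<close>

text \<open>A possibly unbounded, partially defined operator is identified with its graph, a set of
  pairs of functions; its domain is then \<^const>\<open>Domain\<close> and extension is inclusion.\<close>

type_synonym 'a operator = "(('a \<Rightarrow> real) \<times> ('a \<Rightarrow> real)) set"

definition linear_operator :: "'a set \<Rightarrow> ('a \<Rightarrow> real) \<Rightarrow> 'a operator \<Rightarrow> bool" where
  "linear_operator X m T \<longleftrightarrow>
     T \<subseteq> l2 X m \<times> l2 X m \<and>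
     single_valued T \<and>
     ((\<lambda>x. 0), (\<lambda>x. 0)) \<in> T \<and>
     (\<forall>u v u' v'. (u, v) \<in> T \<longrightarrow> (u', v') \<in> T \<longrightarrow>
        ((\<lambda>x. u x + u' x), (\<lambda>x. v x + v' x)) \<in> T) \<and>
     (\<forall>c u v. (u, v) \<in> T \<longrightarrow> ((\<lambda>x. c * u x), (\<lambda>x. c * v x)) \<in> T)"

definition densely_defined :: "'a set \<Rightarrow> ('a \<Rightarrow> real) \<Rightarrow> 'a operator \<Rightarrow> bool" where
  "densely_defined X m T \<longleftrightarrow>
     (\<forall>f \<in> l2 X m. \<forall>e > 0. \<exists>u \<in> Domain T. l2_norm X m (\<lambda>x. f x - u x) < e)"

definition adjoint_operator :: "'a set \<Rightarrow> ('a \<Rightarrow> real) \<Rightarrow> 'a operator \<Rightarrow> 'a operator" where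
  "adjoint_operator X m T =
     {(f, h). f \<in> l2 X m \<and> h \<in> l2 X m \<and>
        (\<forall>(u, v) \<in> T. l2_inner X m v f = l2_inner X m u h)}"

definition self_adjoint :: "'a set \<Rightarrow> ('a \<Rightarrow> real) \<Rightarrow> 'a operator \<Rightarrow> bool" where
  "self_adjoint X m T \<longleftrightarrow>
     linear_operator X m T \<and> densely_defined X m T \<and> adjoint_operator X m T = T"

definition essentially_self_adjoint :: "'a set \<Rightarrow> ('a \<Rightarrow> real) \<Rightarrow> 'a operator \<Rightarrow> bool" where
  "essentially_self_adjoint X m T \<longleftrightarrow> (\<exists>!S. T \<subseteq> S \<and> self_adjoint X m S)"


section \<open>Laplacians on graphs\<close>

text \<open>The sum ranges over \<open>y \<in> X\<close> only, so for a proper subset \<open>X\<close> of the vertices this is the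
  Laplacian of the subgraph induced on \<open>X\<close>: edges leaving \<open>X\<close> do not contribute.\<close>

definition formal_laplacian ::
  "'a set \<Rightarrow> ('a \<Rightarrow> 'a \<Rightarrow> real) \<Rightarrow> ('a \<Rightarrow> real) \<Rightarrow> ('a \<Rightarrow> real) \<Rightarrow> 'a \<Rightarrow> real" where
  "formal_laplacian X b m f x =
     (if x \<in> X then 1 / m x * (\<Sum>\<^sub>\<infinity>y\<in>X. b x y * (f x - f y)) else 0)"

definition minimal_laplacian ::
  "'a set \<Rightarrow> ('a \<Rightarrow> 'a \<Rightarrow> real) \<Rightarrow> ('a \<Rightarrow> real) \<Rightarrow> 'a operator" where
  "minimal_laplacian X b m =
     {(f, formal_laplacian X b m f) | f. (\<forall>x. x \<notin> X \<longrightarrow> f x = 0) \<and> finite {x. f x \<noteq> 0}}"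

definition harmonic ::
  "'a set \<Rightarrow> ('a \<Rightarrow> 'a \<Rightarrow> real) \<Rightarrow> ('a \<Rightarrow> real) \<Rightarrow> ('a \<Rightarrow> real) \<Rightarrow> bool" where
  "harmonic X b m f \<longleftrightarrow> (\<forall>x\<in>X. formal_laplacian X b m f x = 0)"

definition l2_Liouville :: "'a set \<Rightarrow> ('a \<Rightarrow> 'a \<Rightarrow> real) \<Rightarrow> ('a \<Rightarrow> real) \<Rightarrow> bool" where
  "l2_Liouville X b m \<longleftrightarrow>
     (\<forall>f \<in> l2 X m. harmonic X b m f \<longrightarrow> (\<exists>c. \<forall>x\<in>X. f x = c))"


section \<open>Stars with two rays\<close>

definition star_with_two_rays :: "(int \<Rightarrow> int \<Rightarrow> real) \<Rightarrow> (int \<Rightarrow> real) \<Rightarrow> bool" where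
  "star_with_two_rays b m \<longleftrightarrow>
     (\<forall>x y. b x y = b y x) \<and>
     (\<forall>x y. 0 \<le> b x y) \<and>
     (\<forall>x y. 0 < b x y \<longleftrightarrow> \<bar>x - y\<bar> = 1) \<and>
     (\<forall>x. 0 < m x)"

definition transient_at_plus_infinity :: "(int \<Rightarrow> int \<Rightarrow> real) \<Rightarrow> bool" where
  "transient_at_plus_infinity b \<longleftrightarrow> summable (\<lambda>k. 1 / b (int k) (int k + 1))"

definition transient_at_minus_infinity :: "(int \<Rightarrow> int \<Rightarrow> real) \<Rightarrow> bool" where
  "transient_at_minus_infinity b \<longleftrightarrow> summable (\<lambda>k. 1 / b (- int k) (- int k - 1))"

text \<open>The inner series is the tail \<open>\<Sum>k\<ge>r. 1 / b(k, k+1)\<close>. The first conjunct makes the predicate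
  false when this tail is infinite, where \<^const>\<open>suminf\<close> would have an unspecified value.\<close>

definition green_in_l2_at_plus_infinity ::
  "(int \<Rightarrow> int \<Rightarrow> real) \<Rightarrow> (int \<Rightarrow> real) \<Rightarrow> bool" where
  "green_in_l2_at_plus_infinity b m \<longleftrightarrow>
     transient_at_plus_infinity b \<and>
     summable (\<lambda>r. (\<Sum>k. 1 / b (int (r + k)) (int (r + k) + 1))\<^sup>2 * m (int r))"

definition finite_measure_at_plus_infinity :: "(int \<Rightarrow> real) \<Rightarrow> bool" where
  "finite_measure_at_plus_infinity m \<longleftrightarrow> summable (\<lambda>r. m (int r))"

definition negative_part_laplacian ::
  "(int \<Rightarrow> int \<Rightarrow> real) \<Rightarrow> (int \<Rightarrow> real) \<Rightarrow> int operator" where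
  "negative_part_laplacian b m = minimal_laplacian {..-1} b m"

end

(* A harmonic function on the line has constant flux c = b(x,x+1) (f(x) - f(x+1)), so it is an
   affine function of the resistance along each ray. At infinity it tends to a constant and is,
   up to this constant, a multiple of g; at -infinity the resistance R from -1 diverges, so the
   constant is irrelevant there. Hence a nonconstant harmonic function in l^2 exists iff R is in
   l^2 at -infinity and (1) or (2) holds.

   It remains to see that the minimal Laplacian of the negative ray is essentially self-adjoint
   iff R is not in l^2. Green's formula expresses the failure of the maximal operator to be
   symmetric by the limit of the Wronskian W. If R is in l^2, so is the constant 1, and W(f,1) -> 0
   and W(f,R) -> 0 are two boundary conditions giving different self-adjoint extensions. If
   W(f,g) has a nonzero limit for some f, g in the maximal domain, then R is recovered from
   W(f,R), W(g,R), f and g, and a discrete Gronwall argument shows that R is in l^2. *)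

theory Submission
  imports Defs "HOL-Analysis.Convex"
begin

section \<open>Weighted square-summable functions\<close>

lemma l2_mult_summable:
  assumes "f \<in> l2 X m" "g \<in> l2 X m" "\<And>x. x \<in> X \<Longrightarrow> 0 \<le> m x"
  shows "(\<lambda>x. f x * g x * m x) summable_on X"
proof (rule abs_summable_summable, rule abs_summable_on_comparison_test')
  show "(\<lambda>x. (f x)\<^sup>2 * m x + (g x)\<^sup>2 * m x) summable_on X"
    using assms by (auto simp: l2_def intro: summable_on_add)
  fix x assume x: "x \<in> X"
  have "\<bar>f x * g x\<bar> \<le> (f x)\<^sup>2 + (g x)\<^sup>2"
    using sum_squares_bound[of "\<bar>f x\<bar>" "\<bar>g x\<bar>"] abs_ge_zero[of "f x * g x"]
    unfolding abs_mult power2_abs by linarith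
  from mult_right_mono[OF this assms(3)[OF x]]
  show "norm (f x * g x * m x) \<le> (f x)\<^sup>2 * m x + (g x)\<^sup>2 * m x"
    using assms(3)[OF x] by (simp add: abs_mult algebra_simps)
qed

lemma l2_add:
  assumes "f \<in> l2 X m" "g \<in> l2 X m" "\<And>x. x \<in> X \<Longrightarrow> 0 \<le> m x"
  shows "(\<lambda>x. f x + g x) \<in> l2 X m"
proof -
  have "(\<lambda>x. (f x)\<^sup>2 * m x + (g x)\<^sup>2 * m x + f x * g x * m x * 2) summable_on X"
    using assms l2_mult_summable[OF assms]
    by (intro summable_on_add summable_on_cmult_left) (auto simp: l2_def)
  then have "(\<lambda>x. (f x + g x)\<^sup>2 * m x) summable_on X"
    by (simp add: power2_eq_square algebra_simps)
  then show ?thesis using assms by (simp add: l2_def)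
qed

lemma l2_cmult: "f \<in> l2 X m \<Longrightarrow> (\<lambda>x. c * f x) \<in> l2 X m"
  using summable_on_cmult_right[of "\<lambda>x. (f x)\<^sup>2 * m x" X "c\<^sup>2"]
  by (simp add: l2_def algebra_simps)

lemma l2_finite_support:
  assumes "finite {x. f x \<noteq> 0}" "\<And>x. x \<notin> X \<Longrightarrow> f x = 0"
  shows "f \<in> l2 X m"
proof -
  have "(\<lambda>x. (f x)\<^sup>2 * m x) summable_on X"
    by (rule finite_nonzero_values_imp_summable_on, rule finite_subset[OF _ assms(1)]) auto
  then show ?thesis using assms(2) by (simp add: l2_def)
qed

lemma l2_approx_finite_support:
  assumes f: "f \<in> l2 X m" and e: "0 < e"
  shows "\<exists>u. finite {x. u x \<noteq> 0} \<and> (\<forall>x. x \<notin> X \<longrightarrow> u x = 0) \<and> l2_norm X m (\<lambda>x. f x - u x) < e"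
proof -
  let ?q = "\<lambda>x. (f x)\<^sup>2 * m x"
  have q: "?q summable_on X" using f by (simp add: l2_def)
  \<comment> \<open>The approximation is only non-strict, so half of \<open>e\<^sup>2\<close> is
    asked for in order to end strictly below \<open>e\<^sup>2\<close>.\<close>
  obtain F where F: "finite F" "F \<subseteq> X" and d: "dist (sum ?q F) (infsum ?q X) \<le> e\<^sup>2 / 2"
    using infsum_finite_approximation[OF q, of "e\<^sup>2 / 2"] e by auto
  define u where "u x = (if x \<in> F then f x else 0)" for x
  have "l2_inner X m (\<lambda>x. f x - u x) (\<lambda>x. f x - u x) = infsum ?q (X - F)"
    unfolding l2_inner_def u_def
    by (rule infsum_cong_neutral) (auto simp: power2_eq_square)
  also have "\<dots> = infsum ?q X - sum ?q F"
    using infsum_Diff[OF q _ F(2)] F(1) by simp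
  also have "\<dots> < e\<^sup>2"
  proof -
    have "0 < e\<^sup>2" using e by simp
    then show ?thesis using d unfolding dist_real_def by linarith
  qed
  finally have "l2_norm X m (\<lambda>x. f x - u x) < e"
    unfolding l2_norm_def using e real_sqrt_less_iff[of _ "e\<^sup>2"] by simp
  moreover have "finite {x. u x \<noteq> 0}"
    by (rule finite_subset[OF _ F(1)]) (auto simp: u_def)
  ultimately show ?thesis using F(2) by (intro exI[of _ u]) (auto simp: u_def)
qed

lemma adjoint_operator_antimono:
  "S \<subseteq> T \<Longrightarrow> adjoint_operator X m T \<subseteq> adjoint_operator X m S"
  by (fastforce simp: adjoint_operator_def)


section \<open>Elementary inequalities\<close>

lemma power2_diff_le:
  fixes x y :: real
  shows "(x - y)\<^sup>2 \<le> 2 * x\<^sup>2 + 2 * y\<^sup>2"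
  using zero_le_power2[of "x + y"] by (simp add: power2_eq_square algebra_simps)

text \<open>Iterating the step multiplies \<open>V N\<close> by factors \<open>1 + q k\<close>, each
  at most \<open>exp (q k)\<close>; summability of \<open>q\<close> makes the resulting bound
  uniform in \<open>n\<close>.\<close>

lemma discrete_gronwall:
  fixes V q :: "nat \<Rightarrow> real"
  assumes step: "\<And>k. N \<le> k \<Longrightarrow> V (Suc k) \<le> V k * (1 + q k)"
    and V: "\<And>k. 0 \<le> V k" and q: "\<And>k. 0 \<le> q k" and sum_q: "summable q" and n: "N \<le> n"
  shows "V n \<le> V N * exp (suminf q)"
proof -
  have "V n \<le> V N * exp (\<Sum>k<n. q k)"
    using n
  proof (induction n rule: dec_induct)
    case base
    \<comment> \<open>The exponent also counts the indices below \<open>N\<close>, which can only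
      enlarge the bound.\<close>
    have "0 \<le> (\<Sum>k<N. q k)" using q by (intro sum_nonneg) auto
    then show ?case using V[of N] by (simp add: mult_le_cancel_left1)
  next
    case (step n)
    have "V (Suc n) \<le> V n * (1 + q n)" using assms(1) step by simp
    also have "\<dots> \<le> V n * exp (q n)" using V by (intro mult_left_mono) auto
    also have "\<dots> \<le> V N * exp (\<Sum>k<n. q k) * exp (q n)" using step by (intro mult_right_mono) auto
    finally show ?case by (simp add: exp_add mult.assoc)
  qed
  also have "\<dots> \<le> V N * exp (suminf q)"
    using V q sum_q by (intro mult_left_mono) (auto intro: sum_le_suminf)
  finally show ?thesis .
qed


section \<open>Laplacians on the line\<close>

text \<open>The formal Laplacian on its largest domain in l^2. On the negative ray it is the adjoint
  of the minimal one, so self-adjoint extensions are sought among its restrictions.\<close>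

definition maximal_laplacian ::
  "'a set \<Rightarrow> ('a \<Rightarrow> 'a \<Rightarrow> real) \<Rightarrow> ('a \<Rightarrow> real) \<Rightarrow> 'a operator" where
  "maximal_laplacian X b m =
     {(f, formal_laplacian X b m f) | f. f \<in> l2 X m \<and> formal_laplacian X b m f \<in> l2 X m}"

locale star =
  fixes b :: "int \<Rightarrow> int \<Rightarrow> real" and m :: "int \<Rightarrow> real"
  assumes star: "star_with_two_rays b m"
begin

lemma m_pos [simp]: "0 < m x"
  using star by (simp add: star_with_two_rays_def)

lemma m_nonneg [simp]: "0 \<le> m x"
  by (simp add: less_imp_le)

lemma m_neq_0 [simp]: "m x \<noteq> 0"
  using m_pos[of x] by linarith

lemma b_commute: "b x y = b y x"
  using star by (simp add: star_with_two_rays_def)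

lemma b_pos: "\<bar>x - y\<bar> = 1 \<Longrightarrow> 0 < b x y"
  using star by (simp add: star_with_two_rays_def)

lemma b_eq_0: "\<bar>x - y\<bar> \<noteq> 1 \<Longrightarrow> b x y = 0"
  using star unfolding star_with_two_rays_def by (metis less_le)

lemma formal_laplacian_eq:
  assumes "x \<in> X"
  shows "formal_laplacian X b m f x = 1 / m x * (\<Sum>y\<in>{x - 1, x + 1} \<inter> X. b x y * (f x - f y))"
proof -
  have "(\<Sum>\<^sub>\<infinity>y\<in>X. b x y * (f x - f y)) = (\<Sum>\<^sub>\<infinity>y\<in>{x - 1, x + 1} \<inter> X. b x y * (f x - f y))"
    by (rule infsum_cong_neutral) (auto simp: b_eq_0)
  then show ?thesis using assms by (simp add: formal_laplacian_def)
qed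

lemma formal_laplacian_outside [simp]: "x \<notin> X \<Longrightarrow> formal_laplacian X b m f x = 0"
  by (simp add: formal_laplacian_def)

lemma formal_laplacian_add:
  "formal_laplacian X b m (\<lambda>x. f x + g x) =
     (\<lambda>x. formal_laplacian X b m f x + formal_laplacian X b m g x)"
proof
  fix x show "formal_laplacian X b m (\<lambda>x. f x + g x) x =
     formal_laplacian X b m f x + formal_laplacian X b m g x"
    by (cases "x \<in> X")
      (simp_all add: formal_laplacian_eq distrib_left[symmetric] sum.distrib[symmetric] algebra_simps
        add_divide_distrib[symmetric] diff_divide_distrib[symmetric])
qed

lemma formal_laplacian_cmult:
  "formal_laplacian X b m (\<lambda>x. c * f x) = (\<lambda>x. c * formal_laplacian X b m f x)"
proof
  fix x show "formal_laplacian X b m (\<lambda>x. c * f x) x = c * formal_laplacian X b m f x"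
    by (cases "x \<in> X") (simp_all add: formal_laplacian_eq sum_distrib_left algebra_simps)
qed

lemma formal_laplacian_finite_support:
  assumes "finite {x. f x \<noteq> 0}"
  shows "finite {x. formal_laplacian X b m f x \<noteq> 0}"
proof (rule finite_subset)
  let ?S = "{x. f x \<noteq> 0}"
  show "finite (?S \<union> (\<lambda>x. x + 1) ` ?S \<union> (\<lambda>x. x - 1) ` ?S)" using assms by simp
  show "{x. formal_laplacian X b m f x \<noteq> 0} \<subseteq> ?S \<union> (\<lambda>x. x + 1) ` ?S \<union> (\<lambda>x. x - 1) ` ?S"
  proof (rule ccontr)
    assume "\<not> ?thesis"
    then obtain x where x: "formal_laplacian X b m f x \<noteq> 0" "f x = 0"
      and "x \<notin> (\<lambda>x. x + 1) ` ?S" "x \<notin> (\<lambda>x. x - 1) ` ?S" by auto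
    then have "f (x - 1) = 0" "f (x + 1) = 0"
      by (metis (mono_tags, lifting) diff_add_cancel image_eqI mem_Collect_eq)
        (metis (mono_tags, lifting) \<open>x \<notin> (\<lambda>x. x - 1) ` ?S\<close> add_diff_cancel_right' image_eqI mem_Collect_eq)
    then have "(\<Sum>y\<in>{x - 1, x + 1} \<inter> X. b x y * (f x - f y)) = 0"
      using x by (intro sum.neutral) auto
    then show False using x formal_laplacian_eq[of x X f] by (cases "x \<in> X") auto
  qed
qed

lemma linear_operator_maximal: "linear_operator X m (maximal_laplacian X b m)"
proof -
  have "(\<lambda>x. 0) \<in> l2 X m" by (rule l2_finite_support) auto
  moreover have "formal_laplacian X b m (\<lambda>x. 0) = (\<lambda>x. 0)"
    using formal_laplacian_cmult[of X 0 "\<lambda>x. 0"] by simp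
  ultimately show ?thesis
    unfolding linear_operator_def maximal_laplacian_def single_valued_def
    by (auto simp: formal_laplacian_add formal_laplacian_cmult l2_add l2_cmult)
qed

lemma minimal_subset_maximal: "minimal_laplacian X b m \<subseteq> maximal_laplacian X b m"
  unfolding minimal_laplacian_def maximal_laplacian_def
  by (auto simp: l2_finite_support formal_laplacian_finite_support)

lemma densely_defined_if_minimal_subset:
  assumes "minimal_laplacian X b m \<subseteq> T"
  shows "densely_defined X m T"
  unfolding densely_defined_def
proof (intro ballI allI impI)
  fix f and e :: real assume "f \<in> l2 X m" "0 < e"
  then obtain u where u: "finite {x. u x \<noteq> 0}" "\<forall>x. x \<notin> X \<longrightarrow> u x = 0"
    "l2_norm X m (\<lambda>x. f x - u x) < e"
    using l2_approx_finite_support by blast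
  then have "(u, formal_laplacian X b m u) \<in> T"
    using assms by (auto simp: minimal_laplacian_def)
  then show "\<exists>u\<in>Domain T. l2_norm X m (\<lambda>x. f x - u x) < e" using u by blast
qed


section \<open>The Wronskian on the negative ray\<close>

abbreviation neg :: "int set" where "neg \<equiv> {..-1}"

abbreviation L :: "(int \<Rightarrow> real) \<Rightarrow> int \<Rightarrow> real" where "L \<equiv> formal_laplacian neg b m"

abbreviation T_min :: "int operator" where "T_min \<equiv> minimal_laplacian neg b m"

abbreviation T_max :: "int operator" where "T_max \<equiv> maximal_laplacian neg b m"

text \<open>Numbering the negative vertices outwards from -1 turns sums over \<open>neg\<close> into
  series and the end -infinity into \<open>n\<close> tending to infinity.\<close>

definition ray :: "nat \<Rightarrow> int" where "ray n = - 1 - int n"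

definition edge :: "nat \<Rightarrow> real" where "edge n = b (ray n) (ray (Suc n))"

definition wronskian :: "(int \<Rightarrow> real) \<Rightarrow> (int \<Rightarrow> real) \<Rightarrow> nat \<Rightarrow> real" where
  "wronskian f g n = edge n * (f (ray n) * g (ray (Suc n)) - f (ray (Suc n)) * g (ray n))"

lemma ray_mem [simp]: "ray n \<in> neg" "ray n \<le> - 1"
  by (auto simp: ray_def)

lemma edge_pos [simp]: "0 < edge n"
  unfolding edge_def by (rule b_pos) (simp add: ray_def)

lemma edge_neq_0 [simp]: "edge n \<noteq> 0"
  using edge_pos[of n] by linarith

lemma bij_ray: "bij_betw ray UNIV neg"
  by (rule bij_betw_byWitness[where f' = "\<lambda>x. nat (- 1 - x)"]) (auto simp: ray_def)

lemma sums_neg: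
  assumes "f summable_on neg"
  shows "(\<lambda>n. f (ray n)) sums infsum f neg"
proof -
  have "((\<lambda>n. f (ray n)) has_sum infsum f neg) UNIV"
    using has_sum_reindex_bij_betw[OF bij_ray] assms by (metis has_sum_infsum)
  then show ?thesis by (rule has_sum_imp_sums)
qed

lemma l2_neg_iff:
  "f \<in> l2 neg m \<longleftrightarrow> (\<forall>x. x \<notin> neg \<longrightarrow> f x = 0) \<and> summable (\<lambda>n. (f (ray n))\<^sup>2 * m (ray n))"
  using summable_on_reindex_bij_betw[OF bij_ray, of "\<lambda>x. (f x)\<^sup>2 * m x"]
    summable_on_UNIV_nonneg_real_iff[of "\<lambda>n. (f (ray n))\<^sup>2 * m (ray n)"]
  by (simp add: l2_def)

section \<open>Green's formula on the negative ray\<close>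

lemma L_ray_0: "L f (ray 0) * m (ray 0) = edge 0 * (f (ray 0) - f (ray 1))"
proof -
  have "{ray 0 - 1, ray 0 + 1} \<inter> neg = {ray 1}" by (auto simp: ray_def)
  then show ?thesis by (simp add: formal_laplacian_eq edge_def)
qed

lemma L_ray_Suc:
  "L f (ray (Suc n)) * m (ray (Suc n)) =
    edge (Suc n) * (f (ray (Suc n)) - f (ray (Suc (Suc n)))) + edge n * (f (ray (Suc n)) - f (ray n))"
proof -
  have "{ray (Suc n) - 1, ray (Suc n) + 1} \<inter> neg = {ray (Suc (Suc n)), ray n}"
    "ray (Suc (Suc n)) \<noteq> ray n" by (auto simp: ray_def)
  then show ?thesis by (simp add: formal_laplacian_eq edge_def b_commute[of "ray n"])
qed

text \<open>The contributions of inner edges cancel by symmetry of \<open>b\<close>, leaving the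
  edge that leaves the segment at its far end. The near end gives nothing because the induced
  subgraph has no edge from -1 to 0.\<close>

lemma green_partial_sum:
  "(\<Sum>k\<le>n. L f (ray k) * g (ray k) * m (ray k) - f (ray k) * L g (ray k) * m (ray k)) =
    wronskian f g n"
proof (induction n)
  case 0
  have "L f (ray 0) * g (ray 0) * m (ray 0) - f (ray 0) * L g (ray 0) * m (ray 0) =
    (L f (ray 0) * m (ray 0)) * g (ray 0) - f (ray 0) * (L g (ray 0) * m (ray 0))" by simp
  then show ?case unfolding L_ray_0 by (simp add: wronskian_def algebra_simps)
next
  case (Suc n)
  have "L f (ray (Suc n)) * g (ray (Suc n)) * m (ray (Suc n)) - f (ray (Suc n)) * L g (ray (Suc n)) * m (ray (Suc n)) =
    (L f (ray (Suc n)) * m (ray (Suc n))) * g (ray (Suc n)) - f (ray (Suc n)) * (L g (ray (Suc n)) * m (ray (Suc n)))" by simp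
  then show ?case using Suc unfolding L_ray_Suc by (simp add: wronskian_def algebra_simps)
qed

text \<open>Only summability of the two products is assumed, so that a finitely supported
  \<open>f\<close> can be paired with a \<open>g\<close> whose Laplacian is not yet known to be in
  l^2.\<close>

lemma wronskian_tendsto:
  assumes "(\<lambda>x. L f x * g x * m x) summable_on neg" "(\<lambda>x. f x * L g x * m x) summable_on neg"
  shows "wronskian f g \<longlonglongrightarrow> l2_inner neg m (L f) g - l2_inner neg m f (L g)"
proof -
  have "(\<lambda>n. \<Sum>k\<le>n. L f (ray k) * g (ray k) * m (ray k) - f (ray k) * L g (ray k) * m (ray k))
    \<longlonglongrightarrow> l2_inner neg m (L f) g - l2_inner neg m f (L g)"
    using sums_diff[OF sums_neg[OF assms(1)] sums_neg[OF assms(2)]]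
    unfolding l2_inner_def sums_def_le .
  then show ?thesis unfolding green_partial_sum .
qed

lemma wronskian_tendsto_maximal:
  assumes "(f, F) \<in> T_max" "(g, G) \<in> T_max"
  shows "wronskian f g \<longlonglongrightarrow> l2_inner neg m F g - l2_inner neg m f G"
proof -
  have "F = L f" "G = L g" "f \<in> l2 neg m" "L f \<in> l2 neg m" "g \<in> l2 neg m" "L g \<in> l2 neg m"
    using assms by (auto simp: maximal_laplacian_def)
  then show ?thesis using wronskian_tendsto[of f g] l2_mult_summable[of _ neg m] by simp
qed

section \<open>Algebra and vanishing of Wronskians\<close>

lemma wronskian_swap: "wronskian g f n = - wronskian f g n"
  by (simp add: wronskian_def algebra_simps)

lemma wronskian_add: "wronskian (\<lambda>x. f x + g x) h n = wronskian f h n + wronskian g h n"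
  by (simp add: wronskian_def algebra_simps)

lemma wronskian_cmult: "wronskian (\<lambda>x. c * f x) h n = c * wronskian f h n"
  by (simp add: wronskian_def algebra_simps)

text \<open>The Pluecker relation between the 2x2 minors of a 2x4 matrix. It expresses
  \<open>wronskian f h\<close> through Wronskians with a reference pair \<open>p\<close>,
  \<open>q\<close>.\<close>

lemma wronskian_plucker:
  "wronskian f h n * wronskian p q n = wronskian f p n * wronskian h q n - wronskian f q n * wronskian h p n"
  by (simp add: wronskian_def algebra_simps)

lemma wronskian_finite_support:
  assumes "finite {x. u x \<noteq> 0}"
  shows "wronskian u f \<longlonglongrightarrow> 0"
proof -
  have inj: "inj ray" by (simp add: inj_on_def ray_def)
  have fin: "finite (ray -` {x. u x \<noteq> 0})"
    using finite_vimageI[OF assms inj] .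
  obtain N where N: "\<And>n. u (ray n) \<noteq> 0 \<Longrightarrow> n < N"
    using fin unfolding finite_nat_set_iff_bounded by auto
  have "u (ray n) = 0" if "N \<le> n" for n
    using N[of n] that by auto
  then have "\<forall>n\<ge>N. wronskian u f n = 0"
    by (simp add: wronskian_def)
  then show ?thesis
    by (intro tendsto_eventually) (auto simp: eventually_sequentially)
qed

text \<open>Finitely supported functions produce no boundary term in Green's formula, which gives
  one inclusion; testing against point masses gives the other.\<close>

lemma adjoint_minimal: "adjoint_operator neg m T_min = T_max"
proof
  show "T_max \<subseteq> adjoint_operator neg m T_min"
  proof
    fix p assume p: "p \<in> T_max"
    then obtain f where f: "p = (f, L f)" "f \<in> l2 neg m" "L f \<in> l2 neg m"
      by (auto simp: maximal_laplacian_def)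
    have "l2_inner neg m v f = l2_inner neg m u (L f)" if uv: "(u, v) \<in> T_min" for u v
    proof -
      have "wronskian u f \<longlonglongrightarrow> 0"
        using uv by (intro wronskian_finite_support) (auto simp: minimal_laplacian_def)
      moreover have "wronskian u f \<longlonglongrightarrow> l2_inner neg m v f - l2_inner neg m u (L f)"
        using uv p f(1) minimal_subset_maximal by (intro wronskian_tendsto_maximal) auto
      ultimately show ?thesis using LIMSEQ_unique by fastforce
    qed
    then show "p \<in> adjoint_operator neg m T_min" using f by (auto simp: adjoint_operator_def)
  qed
  show "adjoint_operator neg m T_min \<subseteq> T_max"
  proof
    fix p assume "p \<in> adjoint_operator neg m T_min"
    then obtain f h where p: "p = (f, h)" "f \<in> l2 neg m" "h \<in> l2 neg m"
      and adj: "\<And>u v. (u, v) \<in> T_min \<Longrightarrow> l2_inner neg m v f = l2_inner neg m u h"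
      unfolding adjoint_operator_def by blast
    have "h x = L f x" for x
    proof (cases "x \<in> neg")
      case False
      then show ?thesis using p by (auto simp: l2_def)
    next
      case True
      \<comment> \<open>Pairing with the indicator of \<open>x\<close> reads off values at
        \<open>x\<close>, up to the factor \<open>m x\<close>.\<close>
      define u where "u y = (if y = x then 1 else 0 :: real)" for y
      have fin: "finite {y. u y \<noteq> 0}" by (simp add: u_def)
      then have u: "(u, L u) \<in> T_min" using True by (auto simp: minimal_laplacian_def u_def)
      have inner_u: "l2_inner neg m u g = g x * m x" for g
      proof -
        have "l2_inner neg m u g = (\<Sum>\<^sub>\<infinity>y\<in>{x}. g y * m y)"
          unfolding l2_inner_def using True by (intro infsum_cong_neutral) (auto simp: u_def)
        then show ?thesis by simp
      qed
      \<comment> \<open>\<open>L f\<close> is not yet known to be in l^2; the finite supports of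
        \<open>u\<close> and \<open>L u\<close> provide the summability instead.\<close>
      have "wronskian u f \<longlonglongrightarrow> l2_inner neg m (L u) f - l2_inner neg m u (L f)"
      proof (rule wronskian_tendsto)
        show "(\<lambda>x. L u x * f x * m x) summable_on neg"
          by (rule finite_nonzero_values_imp_summable_on,
              rule finite_subset[OF _ formal_laplacian_finite_support[OF fin, of neg]]) auto
        show "(\<lambda>x. u x * L f x * m x) summable_on neg"
          by (rule finite_nonzero_values_imp_summable_on, rule finite_subset[OF _ fin]) auto
      qed
      then have "l2_inner neg m (L u) f = l2_inner neg m u (L f)"
        using LIMSEQ_unique[OF _ wronskian_finite_support[OF fin]] by fastforce
      then have "h x * m x = L f x * m x" using adj[OF u] inner_u by metis
      then show ?thesis by simp
    qed
    then have "h = L f" by blast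
    then show "p \<in> T_max" using p by (auto simp: maximal_laplacian_def)
  qed
qed

section \<open>Self-adjoint extensions\<close>

text \<open>By Green's formula, a vanishing Wronskian at -infinity is exactly symmetry, that is, the
  inclusion of \<open>S\<close> in its adjoint.\<close>

lemma self_adjointI:
  assumes "linear_operator neg m S" "T_min \<subseteq> S" "S \<subseteq> T_max" "adjoint_operator neg m S \<subseteq> S"
    and sym: "\<And>f F g G. (f, F) \<in> S \<Longrightarrow> (g, G) \<in> S \<Longrightarrow> wronskian f g \<longlonglongrightarrow> 0"
  shows "self_adjoint neg m S"
proof -
  have "S \<subseteq> adjoint_operator neg m S"
  proof
    fix p assume p: "p \<in> S"
    then obtain g G where g: "p = (g, G)" "g \<in> l2 neg m" "G \<in> l2 neg m"
      using assms(1) unfolding linear_operator_def by (cases p) auto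
    have "l2_inner neg m F g = l2_inner neg m f G" if f: "(f, F) \<in> S" for f F
    proof -
      have "wronskian f g \<longlonglongrightarrow> l2_inner neg m F g - l2_inner neg m f G"
        using f p g assms(3) by (intro wronskian_tendsto_maximal) auto
      moreover have "wronskian f g \<longlonglongrightarrow> 0" using sym f p g by blast
      ultimately show ?thesis using LIMSEQ_unique by fastforce
    qed
    then show "p \<in> adjoint_operator neg m S" using g by (auto simp: adjoint_operator_def)
  qed
  then show ?thesis
    using assms densely_defined_if_minimal_subset[OF assms(2)] by (auto simp: self_adjoint_def)
qed

text \<open>\<open>T_max\<close> is then symmetric, and its adjoint is contained in that of
  \<open>T_min\<close>, which is \<open>T_max\<close>. Passing to adjoints puts any self-adjoint
  extension \<open>S\<close> of \<open>T_min\<close> inside \<open>T_max\<close>, and a second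
  passage gives the reverse inclusion.\<close>

lemma essentially_self_adjoint_if_wronskian_vanishes:
  assumes "\<And>f F g G. (f, F) \<in> T_max \<Longrightarrow> (g, G) \<in> T_max \<Longrightarrow> wronskian f g \<longlonglongrightarrow> 0"
  shows "essentially_self_adjoint neg m T_min"
  unfolding essentially_self_adjoint_def
proof (rule ex1I[of _ T_max])
  have "adjoint_operator neg m T_max \<subseteq> T_max"
    using adjoint_operator_antimono[OF minimal_subset_maximal] adjoint_minimal by blast
  then have max: "self_adjoint neg m T_max"
    using assms by (intro self_adjointI linear_operator_maximal minimal_subset_maximal) auto
  then show "T_min \<subseteq> T_max \<and> self_adjoint neg m T_max"
    using minimal_subset_maximal by blast
  fix S assume S: "T_min \<subseteq> S \<and> self_adjoint neg m S"
  then have "S \<subseteq> T_max"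
    using adjoint_operator_antimono[of T_min S neg m] adjoint_minimal by (simp add: self_adjoint_def)
  moreover from this have "T_max \<subseteq> S"
    using adjoint_operator_antimono[of S T_max neg m] S max by (simp add: self_adjoint_def)
  ultimately show "S = T_max" by blast
qed

text \<open>A boundary condition at -infinity, prescribed by a reference function \<open>p\<close>:
  Wronskians measure how far \<open>f\<close> is from being asymptotically proportional to
  \<open>p\<close>.\<close>

definition boundary_restriction :: "(int \<Rightarrow> real) \<Rightarrow> int operator" where
  "boundary_restriction p = {(f, F). (f, F) \<in> T_max \<and> wronskian f p \<longlonglongrightarrow> 0}"

lemma minimal_subset_boundary_restriction: "T_min \<subseteq> boundary_restriction p"
proof
  fix x assume x: "x \<in> T_min"
  then obtain u where "x = (u, L u)" "finite {x. u x \<noteq> 0}" by (auto simp: minimal_laplacian_def)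
  then show "x \<in> boundary_restriction p"
    using x minimal_subset_maximal wronskian_finite_support by (auto simp: boundary_restriction_def)
qed

lemma linear_operator_boundary_restriction: "linear_operator neg m (boundary_restriction p)"
proof -
  have max: "linear_operator neg m T_max" by (rule linear_operator_maximal)
  have "T_max \<subseteq> l2 neg m \<times> l2 neg m" "single_valued T_max" and zero: "((\<lambda>x. 0), (\<lambda>x. 0)) \<in> T_max"
    and add: "\<And>u v u' v'. (u, v) \<in> T_max \<Longrightarrow> (u', v') \<in> T_max \<Longrightarrow>
        ((\<lambda>x. u x + u' x), (\<lambda>x. v x + v' x)) \<in> T_max"
    and cmult: "\<And>c u v. (u, v) \<in> T_max \<Longrightarrow> ((\<lambda>x. c * u x), (\<lambda>x. c * v x)) \<in> T_max"
    using max unfolding linear_operator_def by blast+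
  moreover have "boundary_restriction p \<subseteq> T_max" by (auto simp: boundary_restriction_def)
  moreover have "wronskian (\<lambda>x. 0) p = (\<lambda>n. 0)" by (simp add: fun_eq_iff wronskian_def)
  moreover have "wronskian (\<lambda>x. f x + g x) p \<longlonglongrightarrow> 0" if "wronskian f p \<longlonglongrightarrow> 0" "wronskian g p \<longlonglongrightarrow> 0" for f g
    using tendsto_add[OF that] by (simp add: wronskian_add[abs_def])
  moreover have "wronskian (\<lambda>x. c * f x) p \<longlonglongrightarrow> 0" if "wronskian f p \<longlonglongrightarrow> 0" for f c
    using tendsto_mult_left[OF that, of c] by (simp add: wronskian_cmult[abs_def])
  ultimately show ?thesis
    unfolding linear_operator_def boundary_restriction_def
    by (auto intro: single_valued_subset)
qed

text \<open>The function \<open>q\<close> supplies the second direction at the boundary: as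
  \<open>wronskian p q\<close> is a nonzero constant, the Pluecker relation can be divided by it,
  and symmetry follows from the condition on \<open>p\<close> alone.\<close>

lemma self_adjoint_boundary_restriction:
  assumes p: "(p, P) \<in> T_max" and q: "(q, Q) \<in> T_max"
    and c: "c \<noteq> 0" "\<And>n. wronskian p q n = c"
  shows "self_adjoint neg m (boundary_restriction p)"
proof (rule self_adjointI)
  let ?S = "boundary_restriction p"
  show "linear_operator neg m ?S" by (rule linear_operator_boundary_restriction)
  show min: "T_min \<subseteq> ?S" by (rule minimal_subset_boundary_restriction)
  show max: "?S \<subseteq> T_max" by (auto simp: boundary_restriction_def)
  show "adjoint_operator neg m ?S \<subseteq> ?S"
  proof
    fix x assume x: "x \<in> adjoint_operator neg m ?S"
    then have x_max: "x \<in> T_max"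
      using adjoint_operator_antimono[OF min] adjoint_minimal by blast
    obtain h H where h: "x = (h, H)" by (cases x)
    have "wronskian p p = (\<lambda>n. 0)" by (simp add: fun_eq_iff wronskian_def)
    \<comment> \<open>\<open>p\<close> satisfies its own boundary condition, so adjoint elements may
      be tested against it; this forces the condition on them.\<close>
    then have "(p, P) \<in> ?S" using p by (simp add: boundary_restriction_def)
    then have "l2_inner neg m P h = l2_inner neg m p H"
      using x h by (auto simp: adjoint_operator_def)
    then have "wronskian p h \<longlonglongrightarrow> 0"
      using wronskian_tendsto_maximal[OF p, of h H] x_max h by simp
    then have "wronskian h p \<longlonglongrightarrow> 0"
      using tendsto_minus[of "wronskian p h" 0] by (simp add: wronskian_swap[of h p, abs_def])
    then show "x \<in> ?S" using x_max h by (simp add: boundary_restriction_def)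
  qed
  fix f F g G assume f: "(f, F) \<in> ?S" and g: "(g, G) \<in> ?S"
  \<comment> \<open>In each product one factor tends to 0 by the boundary condition while the other
    converges by Green's formula.\<close>
  have "(\<lambda>n. (wronskian f p n * wronskian g q n - wronskian f q n * wronskian g p n) / c) \<longlonglongrightarrow>
     (0 * (l2_inner neg m G q - l2_inner neg m g Q) -
      (l2_inner neg m F q - l2_inner neg m f Q) * 0) / c"
    using f g c q
    by (intro tendsto_divide tendsto_diff tendsto_mult tendsto_const wronskian_tendsto_maximal)
      (auto simp: boundary_restriction_def)
  moreover have "(wronskian f p n * wronskian g q n - wronskian f q n * wronskian g p n) / c =
    wronskian f g n" for n
    using wronskian_plucker[of f g n p q] c by (simp add: field_simps)
  ultimately show "wronskian f g \<longlonglongrightarrow> 0" by simp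
qed

section \<open>The resistance function\<close>

definition one :: "int \<Rightarrow> real" where "one x = (if x \<in> neg then 1 else 0)"

text \<open>The resistance between -1 and \<open>x\<close>. Together with \<open>one\<close> it
  spans the solutions of \<open>L u x = 0\<close> at the vertices below -1.\<close>

definition resistance :: "int \<Rightarrow> real" where
  "resistance x = (if x \<in> neg then \<Sum>k<nat (- 1 - x). 1 / edge k else 0)"

lemma one_ray [simp]: "one (ray n) = 1"
  by (simp add: one_def)

lemma resistance_ray: "resistance (ray n) = (\<Sum>k<n. 1 / edge k)"
  by (simp add: resistance_def) (simp add: ray_def)

lemma wronskian_one_resistance: "wronskian one resistance n = 1"
  by (simp add: wronskian_def resistance_ray)

lemma wronskian_resistance_one: "wronskian resistance one n = - 1"
  using wronskian_swap[of resistance one n] wronskian_one_resistance by simp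

lemma neg_cases:
  assumes "x \<in> neg" obtains n where "x = ray n"
  using bij_ray assms by (auto simp: bij_betw_def)

lemma L_one: "L one = (\<lambda>x. 0)"
proof
  fix x show "L one x = 0"
  proof (cases "x \<in> neg")
    case True
    then obtain n where n: "x = ray n" by (rule neg_cases)
    have "L one (ray n) * m (ray n) = 0"
      by (cases n) (simp_all only: L_ray_0 L_ray_Suc one_ray, simp_all)
    then show ?thesis using n by simp
  qed simp
qed

lemma L_resistance_ray_Suc: "L resistance (ray (Suc n)) = 0"
proof -
  have "L resistance (ray (Suc n)) * m (ray (Suc n)) = 0"
    unfolding L_ray_Suc by (simp add: resistance_ray)
  then show ?thesis by simp
qed

text \<open>\<open>resistance\<close> has the same flux through every edge of the ray, so its
  Laplacian lives only at -1, where this flux has no edge to continue through.\<close>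

lemma L_resistance_l2: "L resistance \<in> l2 neg m"
proof (rule l2_finite_support)
  show "finite {x. L resistance x \<noteq> 0}"
  proof (rule finite_subset)
    show "{x. L resistance x \<noteq> 0} \<subseteq> {ray 0}"
    proof
      fix x assume x: "x \<in> {x. L resistance x \<noteq> 0}"
      then have "x \<in> neg" by (auto intro: ccontr)
      then obtain n where "x = ray n" by (rule neg_cases)
      then show "x \<in> {ray 0}" using x L_resistance_ray_Suc by (cases n) auto
    qed
  qed simp
qed simp

lemma resistance_maximal: "resistance \<in> l2 neg m \<Longrightarrow> (resistance, L resistance) \<in> T_max"
  using L_resistance_l2 by (auto simp: maximal_laplacian_def)

text \<open>Beyond -1 the resistance is at least that of the first edge, so
  \<open>edge 0 * resistance\<close> dominates \<open>one\<close>.\<close>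

lemma one_maximal:
  assumes "resistance \<in> l2 neg m"
  shows "(one, L one) \<in> T_max"
proof -
  have "summable (\<lambda>n. (one (ray n))\<^sup>2 * m (ray n))"
  \<comment> \<open>The comparison starts at 1 because \<open>resistance\<close> vanishes at
    \<open>ray 0\<close>.\<close>
  proof (rule summable_comparison_test'[where N = 1])
    show "summable (\<lambda>n. (edge 0)\<^sup>2 * ((resistance (ray n))\<^sup>2 * m (ray n)))"
      using assms by (intro summable_mult) (simp add: l2_neg_iff)
    fix n :: nat assume n: "1 \<le> n"
    have "1 / edge 0 \<le> resistance (ray n)"
      unfolding resistance_ray using n
      by (intro member_le_sum[where f = "\<lambda>k. 1 / edge k"]) (auto simp: less_imp_le)
    then have "1 \<le> edge 0 * resistance (ray n)" by (simp add: divide_le_eq mult.commute)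
    then have "1 \<le> (edge 0 * resistance (ray n))\<^sup>2" by (simp add: one_le_power)
    from mult_right_mono[OF this m_nonneg]
    show "norm ((one (ray n))\<^sup>2 * m (ray n)) \<le> (edge 0)\<^sup>2 * ((resistance (ray n))\<^sup>2 * m (ray n))"
      by (simp add: power_mult_distrib mult.assoc)
  qed
  then have "one \<in> l2 neg m" by (simp add: l2_neg_iff) (simp add: one_def)
  moreover have "(\<lambda>x. 0) \<in> l2 neg m" by (rule l2_finite_support) auto
  ultimately show ?thesis by (auto simp: maximal_laplacian_def L_one)
qed

text \<open>The boundary conditions given by \<open>one\<close> and by \<open>resistance\<close>
  both define self-adjoint extensions. They differ: \<open>one\<close> meets the first but not the
  second, as its Wronskian with \<open>resistance\<close> is constantly 1.\<close>

lemma not_essentially_self_adjoint: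
  assumes "resistance \<in> l2 neg m"
  shows "\<not> essentially_self_adjoint neg m T_min"
proof
  assume "essentially_self_adjoint neg m T_min"
  moreover have "self_adjoint neg m (boundary_restriction one)"
    by (rule self_adjoint_boundary_restriction[OF one_maximal resistance_maximal, of 1])
      (simp_all add: assms wronskian_one_resistance)
  moreover have "self_adjoint neg m (boundary_restriction resistance)"
    by (rule self_adjoint_boundary_restriction[OF resistance_maximal one_maximal, of "- 1"])
      (simp_all add: assms wronskian_resistance_one)
  ultimately have "boundary_restriction one = boundary_restriction resistance"
    unfolding essentially_self_adjoint_def using minimal_subset_boundary_restriction by blast
  moreover have "(one, L one) \<in> boundary_restriction one"
  proof -
    have "wronskian one one = (\<lambda>n. 0)" by (simp add: fun_eq_iff wronskian_def)
    then show ?thesis using one_maximal[OF assms] by (simp add: boundary_restriction_def)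
  qed
  ultimately have "wronskian one resistance \<longlonglongrightarrow> 0" by (auto simp: boundary_restriction_def)
  moreover have "wronskian one resistance = (\<lambda>n. 1)"
    by (simp add: fun_eq_iff wronskian_one_resistance)
  ultimately show False by (simp add: LIMSEQ_const_iff)
qed

section \<open>Limit point case\<close>

text \<open>The partial sums of the squared l^2 norm of \<open>resistance\<close>; they are bounded
  exactly when \<open>resistance\<close> is in l^2.\<close>

definition energy :: "nat \<Rightarrow> real" where
  "energy n = (\<Sum>k\<le>n. (resistance (ray k))\<^sup>2 * m (ray k))"

lemma energy_nonneg: "0 \<le> energy n"
  unfolding energy_def by (intro sum_nonneg) simp

text \<open>Since \<open>resistance\<close> is harmonic off \<open>-1\<close>, Green's formula leaves one boundary term and a sum
  that Cauchy-Schwarz bounds by \<open>energy\<close>.\<close>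

lemma wronskian_resistance_bound:
  assumes "(f, F) \<in> T_max"
  obtains C where "0 \<le> C" "\<And>n. (wronskian f resistance n)\<^sup>2 \<le> C * (1 + energy n)"
proof -
  have F: "F = L f" "summable (\<lambda>n. (L f (ray n))\<^sup>2 * m (ray n))"
    using assms by (auto simp: maximal_laplacian_def l2_neg_iff)
  define P where "P = (\<Sum>n. (L f (ray n))\<^sup>2 * m (ray n))"
  define d where "d = f (ray 0) * L resistance (ray 0) * m (ray 0)"
  have P: "0 \<le> P" unfolding P_def using F(2) by (intro suminf_nonneg) auto
  have "(wronskian f resistance n)\<^sup>2 \<le> (2 * P + 2 * d\<^sup>2) * (1 + energy n)" for n
  proof -
    define s where "s = (\<Sum>k\<le>n. L f (ray k) * resistance (ray k) * m (ray k))"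
    have "(\<Sum>k\<le>n. f (ray k) * L resistance (ray k) * m (ray k)) = d"
    proof -
      have "(\<Sum>k\<le>n. f (ray k) * L resistance (ray k) * m (ray k)) =
        (\<Sum>k\<in>{0}. f (ray k) * L resistance (ray k) * m (ray k))"
        by (rule sum.mono_neutral_right) (auto simp: L_resistance_ray_Suc gr0_conv_Suc)
      then show ?thesis by (simp add: d_def)
    qed
    then have w: "wronskian f resistance n = s - d"
      unfolding green_partial_sum[symmetric] sum_subtractf s_def by simp
    \<comment> \<open>The weight is split evenly between the two factors, so that Cauchy-Schwarz
      yields two weighted sums of squares.\<close>
    have "s\<^sup>2 = (\<Sum>k\<le>n. (L f (ray k) * sqrt (m (ray k))) * (resistance (ray k) * sqrt (m (ray k))))\<^sup>2"
      unfolding s_def by (intro arg_cong[where f = "\<lambda>x. x\<^sup>2"] sum.cong) (auto simp: algebra_simps)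
    also have "\<dots> \<le> (\<Sum>k\<le>n. (L f (ray k) * sqrt (m (ray k)))\<^sup>2) *
        (\<Sum>k\<le>n. (resistance (ray k) * sqrt (m (ray k)))\<^sup>2)"
      by (rule Cauchy_Schwarz_ineq_sum)
    also have "\<dots> = (\<Sum>k\<le>n. (L f (ray k))\<^sup>2 * m (ray k)) * energy n"
      by (simp add: power_mult_distrib energy_def)
    also have "\<dots> \<le> P * energy n"
      unfolding P_def by (intro mult_right_mono sum_le_suminf F energy_nonneg) auto
    finally have s: "s\<^sup>2 \<le> P * energy n" .
    have "(s - d)\<^sup>2 \<le> 2 * s\<^sup>2 + 2 * d\<^sup>2"
      by (rule power2_diff_le)
    also have "\<dots> \<le> (2 * P + 2 * d\<^sup>2) * (1 + energy n)"
    proof -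
      have "0 \<le> d\<^sup>2 * energy n" using energy_nonneg by simp
      moreover have "(2 * P + 2 * d\<^sup>2) * (1 + energy n) =
        2 * P + 2 * d\<^sup>2 + 2 * (P * energy n) + 2 * (d\<^sup>2 * energy n)" by (simp add: algebra_simps)
      ultimately show ?thesis using s P by linarith
    qed
    finally show ?thesis unfolding w .
  qed
  then show ?thesis using P by (intro that[of "2 * P + 2 * d\<^sup>2"]) auto
qed

text \<open>The Wronskians of \<open>f\<close> and \<open>g\<close> with \<open>resistance\<close>
  form a linear system for its values with determinant governed by \<open>wronskian f g\<close>,
  here bounded away from 0. The bounds on these Wronskians then control the next increment of
  \<open>energy\<close> by \<open>energy\<close> itself.\<close>

lemma energy_step:
  assumes f: "(f, F) \<in> T_max" and g: "(g, G) \<in> T_max"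
    and lim: "wronskian f g \<longlonglongrightarrow> w" "w \<noteq> 0"
  obtains K N where "0 \<le> K" "\<And>n. N \<le> n \<Longrightarrow> (resistance (ray (Suc n)))\<^sup>2 * m (ray (Suc n)) \<le>
     K * (((f (ray (Suc n)))\<^sup>2 + (g (ray (Suc n)))\<^sup>2) * m (ray (Suc n))) * (1 + energy n)"
proof -
  obtain A where A: "0 \<le> A" "\<And>n. (wronskian f resistance n)\<^sup>2 \<le> A * (1 + energy n)"
    using wronskian_resistance_bound[OF f] by blast
  obtain B where B: "0 \<le> B" "\<And>n. (wronskian g resistance n)\<^sup>2 \<le> B * (1 + energy n)"
    using wronskian_resistance_bound[OF g] by blast
  have "\<forall>\<^sub>F n in sequentially. \<bar>w\<bar> / 2 < \<bar>wronskian f g n\<bar>"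
    using order_tendstoD(1)[OF tendsto_rabs[OF lim(1)], of "\<bar>w\<bar> / 2"] lim(2) by simp
  then obtain N where N: "\<And>n. N \<le> n \<Longrightarrow> \<bar>w\<bar> / 2 < \<bar>wronskian f g n\<bar>"
    unfolding eventually_sequentially by blast
  define C where "C = A + B"
  show ?thesis
  \<comment> \<open>The 8 is 2 from squaring a difference times 4 from \<open>wronskian f g\<close>
    eventually exceeding half of \<open>w\<close> in absolute value.\<close>
  proof (rule that[of "8 * C / w\<^sup>2" N])
    show "0 \<le> 8 * C / w\<^sup>2" using A B by (simp add: C_def)
    fix n assume n: "N \<le> n"
    let ?u = "resistance (ray (Suc n))" and ?f = "f (ray (Suc n))" and ?g = "g (ray (Suc n))"
      and ?W = "wronskian f g n" and ?E = "1 + energy n"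
    \<comment> \<open>Cramer's rule: the terms with the value of \<open>resistance\<close> at
      \<open>ray n\<close> cancel.\<close>
    have "?u * ?W = ?g * wronskian f resistance n - ?f * wronskian g resistance n"
      by (simp add: wronskian_def algebra_simps)
    then have "(?u * ?W)\<^sup>2 \<le> 2 * (?g\<^sup>2 * (wronskian f resistance n)\<^sup>2) + 2 * (?f\<^sup>2 * (wronskian g resistance n)\<^sup>2)"
      using power2_diff_le[of "?g * wronskian f resistance n" "?f * wronskian g resistance n"]
      by (simp only: power_mult_distrib)
    also have "\<dots> \<le> 2 * (?g\<^sup>2 * (C * ?E)) + 2 * (?f\<^sup>2 * (C * ?E))"
    proof -
      have "A * ?E \<le> C * ?E" "B * ?E \<le> C * ?E"
        using A B energy_nonneg[of n] by (auto simp: C_def intro!: mult_right_mono)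
      then have "(wronskian f resistance n)\<^sup>2 \<le> C * ?E" "(wronskian g resistance n)\<^sup>2 \<le> C * ?E"
        using A(2)[of n] B(2)[of n] by linarith+
      then show ?thesis by (intro add_mono mult_left_mono) auto
    qed
    also have "\<dots> = 2 * C * (?f\<^sup>2 + ?g\<^sup>2) * ?E" by (simp add: algebra_simps)
    finally have 1: "?u\<^sup>2 * ?W\<^sup>2 \<le> 2 * C * (?f\<^sup>2 + ?g\<^sup>2) * ?E" by (simp add: power_mult_distrib)
    have "(\<bar>w\<bar> / 2)\<^sup>2 \<le> \<bar>?W\<bar>\<^sup>2" using N[OF n] by (intro power_mono) auto
    then have "w\<^sup>2 / 4 \<le> ?W\<^sup>2" by (simp add: power_divide)
    from mult_left_mono[OF this, of "?u\<^sup>2"] 1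
    have "?u\<^sup>2 * w\<^sup>2 \<le> 8 * C * (?f\<^sup>2 + ?g\<^sup>2) * ?E" by simp
    then have "?u\<^sup>2 \<le> 8 * C / w\<^sup>2 * (?f\<^sup>2 + ?g\<^sup>2) * ?E"
      using lim(2) by (simp add: field_simps)
    from mult_right_mono[OF this, of "m (ray (Suc n))"]
    show "?u\<^sup>2 * m (ray (Suc n)) \<le> 8 * C / w\<^sup>2 * ((?f\<^sup>2 + ?g\<^sup>2) * m (ray (Suc n))) * ?E"
      by (simp add: algebra_simps)
  qed
qed

text \<open>For a nonzero limit, the relative growth of \<open>1 + energy\<close> is summable since
  \<open>f\<close> and \<open>g\<close> are in l^2. Gronwall then bounds \<open>energy\<close>,
  which would place \<open>resistance\<close> in l^2.\<close>

lemma wronskian_vanishes: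
  assumes R: "resistance \<notin> l2 neg m" and f: "(f, F) \<in> T_max" and g: "(g, G) \<in> T_max"
  shows "wronskian f g \<longlonglongrightarrow> 0"
proof (rule ccontr)
  assume not0: "\<not> ?thesis"
  obtain w where w: "wronskian f g \<longlonglongrightarrow> w" using wronskian_tendsto_maximal[OF f g] by blast
  then have "w \<noteq> 0" using not0 by auto
  define p where "p n = ((f (ray n))\<^sup>2 + (g (ray n))\<^sup>2) * m (ray n)" for n
  obtain K N where K: "0 \<le> K" and step: "\<And>n. N \<le> n \<Longrightarrow>
     (resistance (ray (Suc n)))\<^sup>2 * m (ray (Suc n)) \<le> K * p (Suc n) * (1 + energy n)"
    using energy_step[OF f g w \<open>w \<noteq> 0\<close>] unfolding p_def by blast
  have "summable p"
    using f g summable_add[of "\<lambda>n. (f (ray n))\<^sup>2 * m (ray n)" "\<lambda>n. (g (ray n))\<^sup>2 * m (ray n)"]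
    unfolding p_def by (auto simp: maximal_laplacian_def l2_neg_iff distrib_right)
  then have sum_q: "summable (\<lambda>n. K * p (Suc n))"
    by (intro summable_mult) (simp add: summable_Suc_iff)
  have q: "0 \<le> K * p (Suc n)" for n
    using K by (simp add: p_def)
  define M where "M = (1 + energy N) * exp (\<Sum>n. K * p (Suc n))"
  have "1 + energy n \<le> M" if "N \<le> n" for n
    unfolding M_def
  proof (rule discrete_gronwall[OF _ _ q sum_q that])
    fix k assume "N \<le> k"
    from step[OF this] show "1 + energy (Suc k) \<le> (1 + energy k) * (1 + K * p (Suc k))"
      by (simp add: energy_def algebra_simps)
  qed (use energy_nonneg in \<open>simp add: add_nonneg_nonneg\<close>)
  then have bound: "energy n \<le> M" if "N \<le> n" for n using that by fastforce
  have "summable (\<lambda>n. (resistance (ray n))\<^sup>2 * m (ray n))"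
  proof (rule summableI_nonneg_bounded)
    fix n
    have "(\<Sum>k<n. (resistance (ray k))\<^sup>2 * m (ray k)) \<le> energy (max n N)"
      unfolding energy_def by (intro sum_mono2) auto
    also have "\<dots> \<le> M" by (rule bound) simp
    finally show "(\<Sum>k<n. (resistance (ray k))\<^sup>2 * m (ray k)) \<le> M" .
  qed simp
  then have "resistance \<in> l2 neg m" by (simp add: l2_neg_iff) (simp add: resistance_def)
  then show False using R by simp
qed

lemma essentially_self_adjoint_iff:
  "essentially_self_adjoint neg m T_min \<longleftrightarrow> resistance \<notin> l2 neg m"
  using not_essentially_self_adjoint wronskian_vanishes
    essentially_self_adjoint_if_wronskian_vanishes by blast


section \<open>Harmonic functions\<close>

text \<open>The counterpart of \<open>resistance\<close> on the positive ray, measured from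
  infinity; it is meaningful under transience there.\<close>

definition green :: "nat \<Rightarrow> real" where
  "green r = (\<Sum>k. 1 / b (int (r + k)) (int (r + k) + 1))"

text \<open>Multiplied by \<open>m x\<close>, the Laplacian is outgoing minus incoming flux at
  \<open>x\<close>, so harmonicity is Kirchhoff's law on a line.\<close>

lemma harmonic_iff_constant_flux:
  "harmonic UNIV b m f \<longleftrightarrow> (\<exists>c. \<forall>x. b x (x + 1) * (f x - f (x + 1)) = c)"
proof -
  define j where "j x = b x (x + 1) * (f x - f (x + 1))" for x
  have lap: "formal_laplacian UNIV b m f x = 1 / m x * (j x - j (x - 1))" for x
    by (subst formal_laplacian_eq) (simp_all add: j_def b_commute[of x "x - 1"] algebra_simps)
  have "harmonic UNIV b m f \<longleftrightarrow> (\<forall>x. j x = j (x - 1))"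
    by (simp add: harmonic_def lap)
  also have "\<dots> \<longleftrightarrow> (\<exists>c. \<forall>x. j x = c)"
  proof
    assume step: "\<forall>x. j x = j (x - 1)"
    have "j x = j 0" for x
    proof (induction x rule: int_induct[where k = 0])
      case (step1 i)
      then show ?case using step[rule_format, of "i + 1"] by simp
    next
      case (step2 i)
      then show ?case using step[rule_format, of i] by simp
    qed simp
    then show "\<exists>c. \<forall>x. j x = c" by blast
  qed auto
  finally show ?thesis by (simp add: j_def)
qed

lemma l2_UNIV_iff:
  "f \<in> l2 UNIV m \<longleftrightarrow> summable (\<lambda>n. (f (ray n))\<^sup>2 * m (ray n)) \<and> summable (\<lambda>n. (f (int n))\<^sup>2 * m (int n))"
proof -
  let ?q = "\<lambda>x. (f x)\<^sup>2 * m x"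
  have bij: "bij_betw int UNIV {0..}"
    by (rule bij_betw_byWitness[where f' = nat]) auto
  have UNIV: "UNIV = neg \<union> {0..}" by auto
  have "?q summable_on UNIV \<longleftrightarrow> ?q summable_on neg \<and> ?q summable_on {0..}"
  proof
    assume "?q summable_on UNIV"
    then show "?q summable_on neg \<and> ?q summable_on {0..}"
      using summable_on_subset_banach[of ?q UNIV] by blast
  next
    assume "?q summable_on neg \<and> ?q summable_on {0..}"
    then show "?q summable_on UNIV"
      unfolding UNIV by (intro summable_on_Un_disjoint) auto
  qed
  also have "?q summable_on neg \<longleftrightarrow> summable (\<lambda>n. ?q (ray n))"
    using summable_on_reindex_bij_betw[OF bij_ray, of ?q]
      summable_on_UNIV_nonneg_real_iff[of "\<lambda>n. ?q (ray n)"] by simp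
  also have "?q summable_on {0..} \<longleftrightarrow> summable (\<lambda>n. ?q (int n))"
    using summable_on_reindex_bij_betw[OF bij, of ?q]
      summable_on_UNIV_nonneg_real_iff[of "\<lambda>n. ?q (int n)"] by simp
  finally show ?thesis by (simp add: l2_def)
qed

section \<open>Constant flux along each ray\<close>

lemma constant_flux_neg:
  assumes "\<And>x. b x (x + 1) * (f x - f (x + 1)) = c"
  shows "f (ray n) = f (ray 0) + c * resistance (ray n)"
proof (induction n)
  case 0
  then show ?case by (simp add: resistance_ray)
next
  case (Suc n)
  have "edge n * (f (ray (Suc n)) - f (ray n)) = c"
    using assms[of "ray (Suc n)"] b_commute by (simp add: edge_def ray_def)
  then have "f (ray (Suc n)) = f (ray n) + c * (1 / edge n)" by (simp add: field_simps)
  then show ?case using Suc by (simp add: resistance_ray distrib_left)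
qed

lemma green_eq:
  assumes "transient_at_plus_infinity b"
  shows "green n = green 0 - (\<Sum>k<n. 1 / b (int k) (int k + 1))"
  using suminf_minus_initial_segment[OF assms[unfolded transient_at_plus_infinity_def], of n]
  by (simp add: green_def add.commute)

lemma green_tendsto_0:
  assumes "transient_at_plus_infinity b"
  shows "green \<longlonglongrightarrow> 0"
proof -
  have "(\<lambda>n. green 0 - (\<Sum>k<n. 1 / b (int k) (int k + 1))) \<longlonglongrightarrow> green 0 - green 0"
    using assms unfolding transient_at_plus_infinity_def
    by (intro tendsto_diff tendsto_const) (simp add: green_def summable_LIMSEQ)
  then show ?thesis using green_eq[OF assms, abs_def] by (simp add: fun_eq_iff[symmetric])
qed

lemma constant_flux_pos:
  assumes "transient_at_plus_infinity b" and flux: "\<And>x. b x (x + 1) * (f x - f (x + 1)) = c"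
  shows "f (int n) = (f 0 - c * green 0) + c * green n"
proof (induction n)
  case 0
  then show ?case by simp
next
  case (Suc n)
  have "b (int n) (int n + 1) \<noteq> 0" using b_pos[of "int n" "int n + 1"] by simp
  then have "f (int (Suc n)) = f (int n) - c * (1 / b (int n) (int n + 1))"
    using flux[of "int n"] by (simp add: field_simps)
  moreover have "green (Suc n) = green n - 1 / b (int n) (int n + 1)"
    using green_eq[OF assms(1), of n] green_eq[OF assms(1), of "Suc n"] by simp
  ultimately show ?case using Suc by (simp only: right_diff_distrib)
qed

lemma green_nonneg:
  assumes "transient_at_plus_infinity b"
  shows "0 \<le> green n"
proof -
  have "summable (\<lambda>k. 1 / b (int (n + k)) (int (n + k) + 1))"
    using summable_ignore_initial_segment[OF assms[unfolded transient_at_plus_infinity_def], of n]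
    by (simp add: add.commute)
  then show ?thesis
    unfolding green_def using b_pos by (intro suminf_nonneg) (auto simp: less_imp_le)
qed

lemma green_le:
  assumes "transient_at_plus_infinity b"
  shows "green n \<le> green 0"
proof -
  have "0 \<le> (\<Sum>k<n. 1 / b (int k) (int k + 1))"
    using b_pos by (intro sum_nonneg) (auto simp: less_imp_le)
  then show ?thesis using green_eq[OF assms, of n] by simp
qed

text \<open>\<open>green\<close> is bounded by \<open>green 0\<close>, so a finite measure makes its
  weighted squares summable.\<close>

lemma green_or_finite_measure_iff:
  assumes "transient_at_plus_infinity b"
  shows "green_in_l2_at_plus_infinity b m \<or> finite_measure_at_plus_infinity m \<longleftrightarrow>
    summable (\<lambda>n. (green n)\<^sup>2 * m (int n))"
proof -
  have "summable (\<lambda>n. (green n)\<^sup>2 * m (int n))" if "summable (\<lambda>n. m (int n))"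
  proof (rule summable_comparison_test'[where N = 0])
    show "summable (\<lambda>n. (green 0)\<^sup>2 * m (int n))" using that by (rule summable_mult)
    show "norm ((green n)\<^sup>2 * m (int n)) \<le> (green 0)\<^sup>2 * m (int n)" for n
      using green_nonneg[OF assms, of n] green_le[OF assms, of n]
      by (simp add: mult_right_mono power_mono)
  qed
  then show ?thesis
    using assms
    by (auto simp: green_in_l2_at_plus_infinity_def finite_measure_at_plus_infinity_def green_def)
qed

text \<open>The limit \<open>B\<close> of \<open>f\<close> at infinity decides between the
  alternatives: if it is 0, then \<open>f\<close> is a multiple of \<open>green\<close>; otherwise
  \<open>f\<close> stays away from 0 and its l^2 norm controls the measure.\<close>

lemma green_l2_if_constant_flux_l2:
  assumes trans: "transient_at_plus_infinity b"
    and flux: "\<And>x. b x (x + 1) * (f x - f (x + 1)) = c" and c: "c \<noteq> 0"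
    and f: "summable (\<lambda>n. (f (int n))\<^sup>2 * m (int n))"
  shows "green_in_l2_at_plus_infinity b m \<or> finite_measure_at_plus_infinity m"
proof -
  define B where "B = f 0 - c * green 0"
  have f_eq: "f (int n) = B + c * green n" for n
    unfolding B_def by (rule constant_flux_pos[OF trans flux])
  show ?thesis
  proof (cases "B = 0")
    case True
    then have "summable (\<lambda>n. (1 / c\<^sup>2) * ((f (int n))\<^sup>2 * m (int n)))"
      using f by (intro summable_mult)
    then have "summable (\<lambda>n. (green n)\<^sup>2 * m (int n))"
      using c True by (simp add: f_eq power_mult_distrib)
    then show ?thesis using green_or_finite_measure_iff[OF trans] by simp
  next
    case False
    have "(\<lambda>n. \<bar>f (int n)\<bar>) \<longlonglongrightarrow> \<bar>B + c * 0\<bar>"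
      unfolding f_eq by (intro tendsto_intros green_tendsto_0 trans)
    from order_tendstoD(1)[OF this, of "\<bar>B\<bar> / 2"] False
    obtain N where N: "\<And>n. N \<le> n \<Longrightarrow> \<bar>B\<bar> / 2 < \<bar>f (int n)\<bar>"
      by (auto simp: eventually_sequentially)
    have "summable (\<lambda>n. m (int n))"
    proof (rule summable_comparison_test'[where N = N])
      show "summable (\<lambda>n. (4 / B\<^sup>2) * ((f (int n))\<^sup>2 * m (int n)))"
        using f by (rule summable_mult)
      fix n assume n: "N \<le> n"
      have "(\<bar>B\<bar> / 2)\<^sup>2 \<le> \<bar>f (int n)\<bar>\<^sup>2" using N[OF n] by (intro power_mono) auto
      then have "1 \<le> 4 / B\<^sup>2 * (f (int n))\<^sup>2" using False by (simp add: power_divide field_simps)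
      from mult_right_mono[OF this m_nonneg]
      show "norm (m (int n)) \<le> 4 / B\<^sup>2 * ((f (int n))\<^sup>2 * m (int n))"
        by (simp add: mult.assoc)
    qed
    then show ?thesis by (simp add: finite_measure_at_plus_infinity_def)
  qed
qed

lemma resistance_eventually_ge:
  assumes "\<not> transient_at_minus_infinity b"
  obtains N where "\<And>n. N \<le> n \<Longrightarrow> K \<le> resistance (ray n)"
proof -
  have "\<not> summable (\<lambda>k. 1 / edge k)"
  proof
    assume "summable (\<lambda>k. 1 / edge k)"
    \<comment> \<open>The edges of the negative part start at -1, whereas transience counts from 0;
      the series differ by one term.\<close>
    moreover have "edge k = b (- int (Suc k)) (- int (Suc k) - 1)" for k
      by (simp add: edge_def ray_def)
    ultimately have "summable (\<lambda>k. 1 / b (- int (Suc k)) (- int (Suc k) - 1))" by simp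
    then have "transient_at_minus_infinity b"
      unfolding transient_at_minus_infinity_def
      using summable_Suc_iff[of "\<lambda>k. 1 / b (- int k) (- int k - 1)"] by blast
    then show False using assms by simp
  qed
  then have "\<exists>N. \<not> (\<Sum>k<N. 1 / edge k) \<le> K"
    using summableI_nonneg_bounded[of "\<lambda>k. 1 / edge k" K] by (auto simp: less_imp_le)
  then obtain N where N: "K < (\<Sum>k<N. 1 / edge k)" by (auto simp: not_le)
  have "K \<le> resistance (ray n)" if "N \<le> n" for n
  proof -
    have "(\<Sum>k<N. 1 / edge k) \<le> resistance (ray n)"
      unfolding resistance_ray using that by (intro sum_mono2) (auto simp: less_imp_le)
    then show ?thesis using N by linarith
  qed
  then show ?thesis by (rule that)
qed

text \<open>Recurrence makes \<open>resistance\<close> unbounded, so eventually the additive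
  constant \<open>A\<close> is at most half of \<open>c * resistance\<close> in absolute value and
  \<open>f\<close> dominates a multiple of \<open>resistance\<close>.\<close>

lemma resistance_l2_if_constant_flux_l2:
  assumes rec: "\<not> transient_at_minus_infinity b"
    and flux: "\<And>x. b x (x + 1) * (f x - f (x + 1)) = c" and c: "c \<noteq> 0"
    and f: "summable (\<lambda>n. (f (ray n))\<^sup>2 * m (ray n))"
  shows "resistance \<in> l2 neg m"
proof -
  define A where "A = f (ray 0)"
  have f_eq: "f (ray n) = A + c * resistance (ray n)" for n
    unfolding A_def by (rule constant_flux_neg[OF flux])
  obtain N where N: "\<And>n. N \<le> n \<Longrightarrow> 2 * \<bar>A\<bar> / \<bar>c\<bar> \<le> resistance (ray n)"
    using resistance_eventually_ge[OF rec] by blast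
  have "summable (\<lambda>n. (resistance (ray n))\<^sup>2 * m (ray n))"
  proof (rule summable_comparison_test'[where N = N])
    show "summable (\<lambda>n. (4 / c\<^sup>2) * ((f (ray n))\<^sup>2 * m (ray n)))"
      using f by (rule summable_mult)
    fix n assume n: "N \<le> n"
    have "2 * \<bar>A\<bar> \<le> \<bar>c * resistance (ray n)\<bar>"
    proof -
      have "2 * \<bar>A\<bar> \<le> \<bar>c\<bar> * resistance (ray n)"
        using N[OF n] c by (simp add: divide_le_eq mult.commute)
      also have "\<dots> \<le> \<bar>c * resistance (ray n)\<bar>" by (simp add: abs_mult mult_left_mono)
      finally show ?thesis .
    qed
    then have "\<bar>c * resistance (ray n)\<bar> \<le> 2 * \<bar>f (ray n)\<bar>" 
      unfolding f_eq by (smt (verit))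
    then have "\<bar>c * resistance (ray n)\<bar>\<^sup>2 \<le> (2 * \<bar>f (ray n)\<bar>)\<^sup>2" by (intro power_mono) auto
    then have "(resistance (ray n))\<^sup>2 \<le> 4 / c\<^sup>2 * (f (ray n))\<^sup>2"
      using c by (simp add: power_mult_distrib field_simps)
    from mult_right_mono[OF this m_nonneg]
    show "norm ((resistance (ray n))\<^sup>2 * m (ray n)) \<le> 4 / c\<^sup>2 * ((f (ray n))\<^sup>2 * m (ray n))"
      by (simp add: mult.assoc)
  qed
  then show ?thesis by (simp add: l2_neg_iff) (simp add: resistance_def)
qed

text \<open>The witness carries unit flux through every edge: \<open>green\<close> on the
  nonnegative part, a shifted \<open>resistance\<close> on the negative part.\<close>

lemma not_Liouville_if:
  assumes trans: "transient_at_plus_infinity b"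
    and R: "resistance \<in> l2 neg m" and G: "summable (\<lambda>n. (green n)\<^sup>2 * m (int n))"
  shows "\<not> l2_Liouville UNIV b m"
proof -
  \<comment> \<open>The shift is chosen so that the edge joining -1 and 0 also carries flux
    1.\<close>
  define A where "A = green 0 + 1 / b (- 1) 0"
  define f where "f x = (if x \<in> neg then A * one x + resistance x else green (nat x))" for x
  have flux: "b x (x + 1) * (f x - f (x + 1)) = 1" for x
  proof -
    \<comment> \<open>The edges inside the negative part, the joining edge, and the edges inside the
      nonnegative part.\<close>
    consider n where "x = ray (Suc n)" | "x = - 1" | n where "x = int n"
    proof -
      consider "x \<le> - 2" | "x = - 1" | "0 \<le> x" by linarith
      then show ?thesis
      proof cases
        case 1
        then have "x = ray (Suc (nat (- 2 - x)))" by (simp add: ray_def)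
        then show ?thesis using that by blast
      next
        case 3
        then show ?thesis using that(3)[of "nat x"] by simp
      qed (use that in blast)
    qed
    then show ?thesis
    proof cases
      case (1 n)
      have "x + 1 = ray n" using 1 by (simp add: ray_def)
      moreover have "f (ray k) = A + resistance (ray k)" for k by (simp add: f_def)
      moreover have "b x (ray n) = edge n" using 1 by (simp add: edge_def b_commute)
      ultimately show ?thesis using 1 by (simp add: resistance_ray)
    next
      case 2
      have "f (- 1) = A" by (simp add: f_def one_def resistance_def)
      moreover have "f 0 = green 0" by (simp add: f_def)
      moreover have "b (- 1) 0 \<noteq> 0" using b_pos[of "- 1" 0] by simp
      ultimately show ?thesis using 2 by (simp add: A_def)
    next
      case (3 n)
      have "b (int n) (int n + 1) \<noteq> 0" using b_pos[of "int n" "int n + 1"] by simp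
      moreover have "f (int n) = green n" "f (int n + 1) = green (Suc n)"
        by (simp_all add: f_def nat_add_distrib)
      ultimately show ?thesis
        using 3 green_eq[OF trans, of n] green_eq[OF trans, of "Suc n"] by simp
    qed
  qed
  then have "harmonic UNIV b m f" by (auto simp: harmonic_iff_constant_flux)
  moreover have "f \<in> l2 UNIV m"
  proof -
    have "(\<lambda>x. A * one x + resistance x) \<in> l2 neg m"
      using one_maximal[OF R] R by (intro l2_add l2_cmult) (auto simp: maximal_laplacian_def)
    then have "summable (\<lambda>n. (f (ray n))\<^sup>2 * m (ray n))" by (simp add: l2_neg_iff f_def)
    moreover have "summable (\<lambda>n. (f (int n))\<^sup>2 * m (int n))" using G by (simp add: f_def)
    ultimately show ?thesis by (simp add: l2_UNIV_iff)
  qed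
  moreover have "\<nexists>c. \<forall>x\<in>UNIV. f x = c"
  proof
    assume "\<exists>c. \<forall>x\<in>UNIV. f x = c"
    then have "f 0 = f 1" by auto
    then show False using flux[of 0] by simp
  qed
  ultimately show ?thesis unfolding l2_Liouville_def by blast
qed

lemma not_Liouville_iff:
  assumes trans: "transient_at_plus_infinity b" and rec: "\<not> transient_at_minus_infinity b"
  shows "\<not> l2_Liouville UNIV b m \<longleftrightarrow> resistance \<in> l2 neg m \<and>
    (green_in_l2_at_plus_infinity b m \<or> finite_measure_at_plus_infinity m)"
proof
  assume "\<not> l2_Liouville UNIV b m"
  then obtain f where f: "f \<in> l2 UNIV m" "harmonic UNIV b m f" "\<nexists>c. \<forall>x. f x = c"
    by (auto simp: l2_Liouville_def)
  then obtain c where flux: "\<And>x. b x (x + 1) * (f x - f (x + 1)) = c"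
    by (auto simp: harmonic_iff_constant_flux)
  \<comment> \<open>Without flux, neighbouring values agree and \<open>f\<close> is constant on the
    connected line.\<close>
  have "c \<noteq> 0"
  proof
    assume "c = 0"
    then have step: "f x = f (x + 1)" for x
      using flux[of x] b_pos[of x "x + 1"] by simp
    have "f x = f 0" for x
    proof (induction x rule: int_induct[where k = 0])
      case (step1 i)
      then show ?case using step[of i] by simp
    next
      case (step2 i)
      then show ?case using step[of "i - 1"] by simp
    qed simp
    then show False using f(3) by blast
  qed
  then show "resistance \<in> l2 neg m \<and>
    (green_in_l2_at_plus_infinity b m \<or> finite_measure_at_plus_infinity m)"
    using f(1) resistance_l2_if_constant_flux_l2[OF rec flux] green_l2_if_constant_flux_l2[OF trans flux]
    by (simp add: l2_UNIV_iff)
next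
  assume "resistance \<in> l2 neg m \<and>
    (green_in_l2_at_plus_infinity b m \<or> finite_measure_at_plus_infinity m)"
  then show "\<not> l2_Liouville UNIV b m"
    using not_Liouville_if[OF trans] green_or_finite_measure_iff[OF trans] by blast
qed

end

theorem proposition4p43:
  fixes b :: "int \<Rightarrow> int \<Rightarrow> real" and m :: "int \<Rightarrow> real"
  assumes "star_with_two_rays b m"
    and "transient_at_plus_infinity b"
    and "\<not> transient_at_minus_infinity b"
  shows "\<not> l2_Liouville UNIV b m \<longleftrightarrow>
    \<not> essentially_self_adjoint {..-1} m (negative_part_laplacian b m) \<and>
    (green_in_l2_at_plus_infinity b m \<or> finite_measure_at_plus_infinity m)"
proof -
  interpret star b m by unfold_locales (rule assms(1))
  show ?thesis
    unfolding negative_part_laplacian_def essentially_self_adjoint_iff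
    using not_Liouville_iff[OF assms(2,3)] by simp
qed

end
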